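(* Suppose that $\{c_n\}$ and $\{d_n\}$ are two increasing sequences of positive real numbers, both in $o(n)$, such that the differences $c_{n+1}-c_n$ and $d_{n+1}-d_n$ are in $O(1)$, and at least one of $\{c_n\}$, $\{d_n\}$ is divergent. Then there is a dense set of irrational $\theta\in(0,1)$ such that all of the following hold: if $\{c_n\}$ is divergent, then $$\limsup_{n\to\infty}\frac{M_n(0)}{c_n}=1,$$ while if $\{c_n\}$ is bounded then so is $\{M_n(0)\}$; and if $\{d_n\}$ is divergent, then $$\limsup_{n\to\infty}\frac{|m_n(0)|}{d_n}=1,$$ while if $\{d_n\}$ is bounded then so is $\{m_n(0)\}$.
   Context: Let $f=\chi_{[0,1/2)}-\chi_{[1/2,1)}$ on $[0,1)$ (addition modulo one). For irrational $\theta$ and $x\in[0,1)$ put $S_n(x)=\sum_{i=0}^{n-1}f(x+i\theta)$, and for $n\ge2$ put $M_n(x)=\max\{S_i(x):i=1,\dots,n-1\}$ and $m_n(x)=\min\{S_i(x):i=1,\dots,n-1\}$ (these depend on $\theta$). *)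

theory Defs
  imports "HOL-Analysis.Analysis" "HOL-Library.Landau_Symbols"
begin

definition step_fun :: "real \<Rightarrow> real" where
  "step_fun x = indicator {0..<1/2} x - indicator {1/2..<1} x"

(* Addition modulo one on [0,1) is realised by the fractional part. *)
definition erg_sum :: "real \<Rightarrow> nat \<Rightarrow> real \<Rightarrow> real" where
  "erg_sum \<theta> n x = (\<Sum>i<n. step_fun (frac (x + real i * \<theta>)))"

(* The maximum and the minimum are meaningful only for n \<ge> 2; for smaller n
   they are taken over the empty set and are unspecified. *)
definition max_sum :: "real \<Rightarrow> nat \<Rightarrow> real \<Rightarrow> real" where
  "max_sum \<theta> n x = Max {erg_sum \<theta> i x |i. i \<in> {1..n-1}}"

definition min_sum :: "real \<Rightarrow> nat \<Rightarrow> real \<Rightarrow> real" where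
  "min_sum \<theta> n x = Min {erg_sum \<theta> i x |i. i \<in> {1..n-1}}"

end

theory Submission
  imports Defs
begin

text \<open>
  Let \<open>e = p / (2h)\<close> be in lowest terms and let \<open>r = p1 / q\<close> be a left Farey neighbour of \<open>e\<close>, so that
  \<open>q\<close> is odd. The sums of the rotation by \<open>r\<close> increase by exactly 1 in each period \<open>q\<close>, and within
  the first period they exceed the range of the sums of \<open>e\<close> by at most 1, and only upwards. The number
  \<open>e' = (2 A p1 + p) / (2 A q + 2 h)\<close> lies between \<open>r\<close> and \<open>e\<close>, has the same form as \<open>e\<close>, and shares
  the sums of \<open>r\<close> up to half of its denominator. Passing from \<open>e\<close> to \<open>e'\<close> therefore raises the
  maximum to about \<open>A\<close> at time \<open>A q\<close> and leaves the minimum unchanged. Since \<open>c\<close> is \<open>o(n)\<close> and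
  divergent, one can take \<open>q\<close> so large that \<open>c q\<close> dwarfs the previous maximum, and then let \<open>A\<close> be the
  first number of periods after which the maximum catches up with \<open>c\<close>. The reflection \<open>\<theta> \<mapsto> - \<theta>\<close> turns
  sums \<open>S\<close> into \<open>2 - S\<close> and gives the step that lowers the minimum instead. Alternating the two
  steps, starting from any dyadic \<open>e\<close>, produces the required \<open>\<theta>\<close> in the limit.
\<close>

section \<open>Sums along fractions with even denominator, and approximation by them\<close>

text \<open>The half of the circle containing \<open>y\<close> is the parity of the floor of
  \<open>2 * y\<close>; for rational rotations this turns fractional parts into integer
  division.\<close>

definition sg :: "int \<Rightarrow> real" where
  "sg k = (if even k then 1 else - 1)"

lemma step_fun_frac: "step_fun (frac y) = sg \<lfloor>2 * y\<rfloor>"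
proof (cases "frac y < 1/2")
  case True
  then have "\<lfloor>2 * y\<rfloor> = 2 * \<lfloor>y\<rfloor>"
    by (simp add: floor_eq_iff frac_def)
  with True show ?thesis
    by (simp add: sg_def step_fun_def indicator_def)
next
  case False
  then have "\<lfloor>2 * y\<rfloor> = 2 * \<lfloor>y\<rfloor> + 1"
    using frac_lt_1[of y] by (simp add: floor_eq_iff frac_def)
  with False show ?thesis
    using frac_lt_1[of y] by (simp add: sg_def step_fun_def indicator_def)
qed

lemma sg_bounds: "\<bar>sg k\<bar> = 1"
  by (simp add: sg_def)

text \<open>Encodes \<open>p / (2 * h)\<close> in lowest terms. Then \<open>p\<close> is odd and
  \<open>h\<close> is the first positive time at which the orbit of 0 meets a jump point, namely
  \<open>1/2\<close>.\<close>

definition hub :: "int \<Rightarrow> nat \<Rightarrow> bool" where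
  "hub p h \<longleftrightarrow> h \<ge> 1 \<and> coprime p (2 * int h)"

definition walk :: "int \<Rightarrow> nat \<Rightarrow> nat \<Rightarrow> real" where
  "walk p h n = (\<Sum>i<n. sg ((int i * p) div int h))"

text \<open>
  The radius is small enough that every \<open>\<theta> \<in> near p h\<close> has the same sums as \<open>p / (2 * h)\<close> up to time \<open>h\<close>.
\<close>
definition near :: "int \<Rightarrow> nat \<Rightarrow> real set" where
  "near p h = cball (of_int p / (2 * real h)) (1 / (2 * (real h)\<^sup>2))"

lemma hub_not_dvd:
  assumes "hub p h" "0 < i" "i < h"
  shows "\<not> int h dvd int i * p"
proof
  assume "int h dvd int i * p"
  moreover have "coprime (int h) p"
    using assms(1) by (auto simp: hub_def coprime_commute)
  ultimately have "int h dvd int i"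
    by (simp add: coprime_dvd_mult_left_iff)
  with assms(2,3) show False
    by (auto dest: zdvd_imp_le)
qed

text \<open>As \<open>h\<close> does not divide \<open>i * p\<close>, the number
  \<open>i * p / h\<close> is at least \<open>1 / h\<close> away from every integer, while passing
  to \<open>2 * i * \<theta>\<close> moves it by at most \<open>i / h^2 < 1 / h\<close>. The strict
  inequality serves to prove irrationality.\<close>

lemma near_floor:
  assumes "hub p h" "\<theta> \<in> near p h" "0 < i" "i < h"
  shows "\<lfloor>2 * (real i * \<theta>)\<rfloor> = (int i * p) div int h"
    and "of_int ((int i * p) div int h) < 2 * (real i * \<theta>)"
proof -
  define z where "z = (int i * p) div int h"
  define w where "w = (int i * p) mod int h"
  have h: "h > 0" using assms(1) by (simp add: hub_def)
  have "w \<noteq> 0"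
    using hub_not_dvd[OF assms(1,3,4)] by (auto simp: w_def dvd_eq_mod_eq_0)
  moreover have "w \<ge> 0" "w < int h" using h by (auto simp: w_def)
  ultimately have w: "1 \<le> w" "w + 1 \<le> int h" by auto
  have "int i * p = z * int h + w"
    by (simp add: z_def w_def)
  then have eq: "real i * of_int p = of_int z * real h + of_int w"
    by (metis of_int_add of_int_mult of_int_of_nat_eq)
  have "\<bar>\<theta> - of_int p / (2 * real h)\<bar> \<le> 1 / (2 * (real h)\<^sup>2)"
    using assms(2) by (simp add: near_def dist_real_def abs_minus_commute)
  then have "2 * (real h * real i) * \<bar>\<theta> - of_int p / (2 * real h)\<bar> \<le> 2 * (real h * real i) * (1 / (2 * (real h)\<^sup>2))"
    by (intro mult_left_mono) auto
  also have "\<dots> = real i / real h"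
    using h by (simp add: power2_eq_square field_simps)
  also have "\<dots> < 1" using assms(4) by simp
  also have "2 * (real h * real i) * \<bar>\<theta> - of_int p / (2 * real h)\<bar>
      = \<bar>2 * (real h * real i) * (\<theta> - of_int p / (2 * real h))\<bar>"
    by (simp add: abs_mult)
  also have "2 * (real h * real i) * (\<theta> - of_int p / (2 * real h))
      = real h * (2 * (real i * \<theta>)) - real i * of_int p"
    using h by (simp add: field_simps)
  finally have *: "\<bar>real h * (2 * (real i * \<theta>)) - (of_int z * real h + of_int w)\<bar> < 1"
    by (simp add: eq)
  have w': "1 \<le> real_of_int w" "real_of_int w + 1 \<le> real h"
    using w by linarith+
  have "real h * of_int z < real h * (2 * (real i * \<theta>))"
    using abs_less_iff[THEN iffD1, OF *] w'(1) mult.commute[of "real h" "of_int z"] by linarith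
  then show lo: "of_int ((int i * p) div int h) < 2 * (real i * \<theta>)"
    using h by (subst (asm) mult_less_cancel_left_pos) (auto simp: z_def)
  have "real h * (2 * (real i * \<theta>)) < real h * (of_int z + 1)"
    using abs_less_iff[THEN iffD1, OF *] w'(2) distrib_left[of "real h" "of_int z" 1]
      mult.commute[of "real h" "of_int z"] by linarith
  then have "2 * (real i * \<theta>) < of_int z + 1"
    using h by (subst (asm) mult_less_cancel_left_pos) auto
  with lo show "\<lfloor>2 * (real i * \<theta>)\<rfloor> = (int i * p) div int h"
    by (intro floor_unique) (auto simp: z_def)
qed

lemma erg_sum_near:
  assumes "hub p h" "\<theta> \<in> near p h" "n \<le> h"
  shows "erg_sum \<theta> n 0 = walk p h n"
  unfolding erg_sum_def walk_def
proof (rule sum.cong)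
  fix i assume "i \<in> {..<n}"
  then show "step_fun (frac (0 + real i * \<theta>)) = sg ((int i * p) div int h)"
    using near_floor(1)[OF assms(1,2), of i] assms(3)
    unfolding step_fun_frac by (cases "i = 0") auto
qed simp

text \<open>If \<open>\<theta>\<close> had denominator \<open>b\<close>, then
  \<open>2 * b * \<theta>\<close> would be an integer, against the strict inequality of
  \<open>near_floor\<close> at time \<open>b < h\<close>.\<close>

lemma irrational_of_near:
  assumes "\<And>N. \<exists>p h. hub p h \<and> \<theta> \<in> near p h \<and> h > N"
  shows "\<theta> \<notin> \<rat>"
proof
  assume "\<theta> \<in> \<rat>"
  then obtain a b :: int where ab: "b > 0" "\<theta> = of_int a / of_int b"
    by (metis Rats_cases')
  obtain p h where ph: "hub p h" "\<theta> \<in> near p h" "h > nat b"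
    using assms by blast
  have "2 * (real (nat b) * \<theta>) = of_int (2 * a)"
    using ab by simp
  with near_floor[OF ph(1,2), of "nat b"] ph(3) ab(1) show False
    by (metis floor_of_int less_irrefl zero_less_nat_eq)
qed

section \<open>Reflection of the rotation\<close>

lemma walk_1: "hub p h \<Longrightarrow> walk p h 1 = 1"
  by (simp add: walk_def sg_def)

lemma div_uminus_minus_1:
  fixes a b :: int
  assumes "b > 0"
  shows "(- a - 1) div b = - (a div b) - 1"
proof (rule int_div_pos_eq[where r = "b - 1 - a mod b"])
  show "- a - 1 = b * (- (a div b) - 1) + (b - 1 - a mod b)"
    using mult_div_mod_eq[of b a] by (simp add: algebra_simps)
qed (use assms pos_mod_bound[of b a] pos_mod_sign[of b a] in linarith)+

lemma div_minus_1_not_dvd: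
  fixes a b :: int
  assumes "b > 0" "\<not> b dvd a"
  shows "(a - 1) div b = a div b"
proof (rule int_div_pos_eq[where r = "a mod b - 1"])
  have "a mod b \<noteq> 0" using assms(2) by (simp add: dvd_eq_mod_eq_0)
  then show "0 \<le> a mod b - 1"
    using assms(1) pos_mod_sign[of b a] by linarith
  show "a mod b - 1 < b" using assms(1) pos_mod_bound[of b a] by linarith
qed simp

lemma div_uminus_not_dvd:
  fixes a b :: int
  assumes "b > 0" "\<not> b dvd a"
  shows "(- a) div b = - (a div b) - 1"
  using div_uminus_minus_1[of b "a - 1"] div_minus_1_not_dvd[OF assms] assms(1) by simp

lemma sg_minus_1: "sg (- k - 1) = - sg k"
  by (auto simp: sg_def)

lemma hub_uminus: "hub (- p) h \<longleftrightarrow> hub p h"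
  by (simp add: hub_def)

lemma walk_split:
  assumes "1 \<le> n"
  shows "walk p h n = 1 + (\<Sum>i\<in>{1..<n}. sg ((int i * p) div int h))"
proof -
  have "{..<n} = insert 0 {1..<n}" using assms by auto
  then show ?thesis by (simp add: walk_def sg_def)
qed

text \<open>All terms with \<open>i > 0\<close> change sign, as they avoid the jumps; the term at
  \<open>i = 0\<close> is 1 in both walks, whence the constant 2.\<close>

lemma walk_uminus:
  assumes "hub p h" "1 \<le> n" "n \<le> h"
  shows "walk (- p) h n = 2 - walk p h n"
proof -
  have "(\<Sum>i\<in>{1..<n}. sg ((int i * - p) div int h)) = (\<Sum>i\<in>{1..<n}. - sg ((int i * p) div int h))"
  proof (rule sum.cong)
    fix i assume "i \<in> {1..<n}"
    then have "(- (int i * p)) div int h = - ((int i * p) div int h) - 1"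
      using assms(1) hub_not_dvd[OF assms(1), of i] assms(3)
      by (intro div_uminus_not_dvd) (auto simp: hub_def)
    then show "sg ((int i * - p) div int h) = - sg ((int i * p) div int h)"
      by (simp add: sg_minus_1)
  qed simp
  then show ?thesis using assms(2) by (simp add: walk_split sum_negf)
qed

section \<open>Sums along a left Farey neighbour\<close>

text \<open>
  The increments \<open>g\<close> are those of the rotation by \<open>p / (2 * h)\<close> minus an infinitesimal: the jump
  points \<open>0\<close> and \<open>1/2\<close> are met from the left. Their partial sums have period \<open>2 * h\<close>, and the
  reflection \<open>i \<mapsto> 2 * h - i\<close> reduces the second half of a period to the first.
\<close>
lemma walk_left_neighbour_bounds:
  assumes hub: "hub p h"
    and bd: "\<forall>n\<in>{1..h}. m \<le> walk p h n \<and> walk p h n \<le> M"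
    and n: "1 \<le> n"
  defines "g \<equiv> \<lambda>i. sg ((int i * p - 1) div int h)"
  shows "m \<le> 1 + sum g {1..<n}" "1 + sum g {1..<n} \<le> M + 1"
proof -
  define G where "G = (\<lambda>n. 1 + sum g {1..<n})"
  have h: "h \<ge> 1" using hub by (simp add: hub_def)
  have "odd p"
    using hub by (auto simp: hub_def coprime_mult_right_iff)
  have step: "G (Suc n) = G n + g n" if "1 \<le> n" for n
    using that by (simp add: G_def)
  have refl: "g (2 * h - i) = - sg ((int i * p) div int h)" if "i < 2 * h" for i
  proof -
    have "int (2 * h - i) * p - 1 = (- (int i * p) - 1) + (2 * p) * int h"
      using that by (simp add: of_nat_diff algebra_simps)
    moreover have "\<dots> div int h = 2 * p + (- (int i * p) - 1) div int h"
      using h by (intro div_mult_self1) auto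
    moreover have "(- (int i * p) - 1) div int h = - ((int i * p) div int h) - 1"
      using h by (intro div_uminus_minus_1) auto
    ultimately have "(int (2 * h - i) * p - 1) div int h = 2 * p + (- ((int i * p) div int h) - 1)"
      by (simp only:)
    then show ?thesis by (simp only: g_def sg_def) simp
  qed
  have low: "G n = walk p h n" if "1 \<le> n" "n \<le> h" for n
    using that
  proof (induction n rule: dec_induct)
    case base
    then show ?case by (simp add: G_def walk_def sg_def)
  next
    case (step n)
    have "(int n * p - 1) div int h = (int n * p) div int h"
      using step hub_not_dvd[OF hub, of n] by (intro div_minus_1_not_dvd) auto
    with step show ?case by (simp add: G_def g_def walk_def)
  qed
  \<comment> \<open>At time \<open>h\<close> the orbit is at \<open>1/2\<close>, which counts +1
    when met from the left. This is the source of the extra 1 in the upper bound.\<close>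
  have "(int h * p - 1) div int h = p + (- 1) div int h"
    using h div_mult_self1[of "int h" "- 1" p] by (simp add: algebra_simps)
  moreover have "(- 1) div int h = - 1"
    using h by (simp add: div_eq_minus1)
  ultimately have "g h = 1"
    using \<open>odd p\<close> by (simp add: g_def sg_def)
  then have mid: "G (h + 1) = walk p h h + 1"
    using step[OF h] low[OF h] by simp
  \<comment> \<open>Past the midpoint the sums retrace their path one unit higher: by
    \<open>refl\<close>, the new term cancels the last term of
    \<open>walk p h (h - v)\<close>.\<close>
  have high: "G (h + 1 + v) = walk p h (h - v) + 1" if "v < h" for v
    using that
  proof (induction v)
    case 0
    then show ?case using mid by simp
  next
    case (Suc v)
    then have "h - v = Suc (h - Suc v)" "2 * h - (h - Suc v) = h + 1 + v" by simp_all
    with Suc step[of "h + 1 + v"] refl[of "h - Suc v"] show ?case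
      by (simp add: walk_def)
  qed
  \<comment> \<open>At time \<open>2 * h\<close> the point 0 is met from the left and counts -1, so
    \<open>G\<close> is back at \<open>G 1 = 1\<close>.\<close>
  have end1: "G (2 * h + 1) = 1"
  proof -
    have "G (2 * h) = 2"
      using high[of "h - 1"] h walk_1[OF hub] by (simp add: mult_2)
    moreover have "g (2 * h) = - 1"
      using refl[of 0] h by (simp add: sg_def)
    ultimately show ?thesis using step[of "2 * h"] h by simp
  qed
  have per: "g (i + 2 * h) = g i" for i
  proof -
    have "int (i + 2 * h) * p - 1 = (int i * p - 1) + (2 * p) * int h"
      by (simp add: algebra_simps)
    moreover have "\<dots> div int h = 2 * p + (int i * p - 1) div int h"
      using h by (intro div_mult_self1) auto
    ultimately have "(int (i + 2 * h) * p - 1) div int h = 2 * p + (int i * p - 1) div int h"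
      by (simp only:)
    then show ?thesis by (simp only: g_def sg_def) simp
  qed
  have Gper: "G (n + 2 * h) = G n" if "1 \<le> n" for n
    using that
  proof (induction n rule: dec_induct)
    case base
    then show ?case using end1 by (simp add: G_def)
  next
    case (step n)
    then show ?case
      using \<open>\<And>n. 1 \<le> n \<Longrightarrow> G (Suc n) = G n + g n\<close>[of n]
        \<open>\<And>n. 1 \<le> n \<Longrightarrow> G (Suc n) = G n + g n\<close>[of "n + 2 * h"] per[of n] by simp
  qed
  have "m \<le> G n \<and> G n \<le> M + 1"
    using n
  proof (induction n rule: less_induct)
    case (less n)
    consider "n \<le> h" | "h < n" "n \<le> 2 * h" | "2 * h < n" by linarith
    then show ?case
    proof cases
      case 1
      then show ?thesis using low[of n] bspec[OF bd, of n] less.prems by force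
    next
      case 2
      then show ?thesis
        using high[of "n - (h + 1)"] bspec[OF bd, of "h - (n - (h + 1))"] by force
    next
      case 3
      then show ?thesis
        using Gper[of "n - 2 * h"] less.IH[of "n - 2 * h"] h by force
    qed
  qed
  then show "m \<le> 1 + sum g {1..<n}" "1 + sum g {1..<n} \<le> M + 1"
    by (auto simp: G_def)
qed

text \<open>The terms at \<open>i\<close> and \<open>q - i\<close> cancel for
  \<open>0 < i < q\<close>, because for odd \<open>q\<close> no such point is a jump; only the 1 at
  \<open>i = 0\<close> survives.\<close>

lemma walk_period_odd:
  assumes q: "q \<ge> 1" and cop: "coprime p (int q)" and odd: "odd q"
  shows "walk (2 * p) q q = 1"
proof -
  define s where "s = (\<lambda>i. sg ((int i * (2 * p)) div int q))"
  have "sum s {1..<q} = (\<Sum>i\<in>{1..<q}. s (q - i))"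
    by (rule sum.reindex_bij_witness[where i = "\<lambda>i. q - i" and j = "\<lambda>i. q - i"]) auto
  also have "\<dots> = (\<Sum>i\<in>{1..<q}. - s i)"
  proof (rule sum.cong)
    fix i assume i: "i \<in> {1..<q}"
    have "\<not> int q dvd int i * (2 * p)"
    proof
      assume "int q dvd int i * (2 * p)"
      moreover have "coprime (int q) (2 * p)"
        using cop odd by (simp add: coprime_commute)
      ultimately have "int q dvd int i"
        by (simp add: coprime_dvd_mult_left_iff)
      with i show False by (auto dest: zdvd_imp_le)
    qed
    then have "(- (int i * (2 * p))) div int q = - ((int i * (2 * p)) div int q) - 1"
      using q by (intro div_uminus_not_dvd) auto
    moreover have "int (q - i) * (2 * p) = - (int i * (2 * p)) + (2 * p) * int q"
      using i by (simp add: of_nat_diff algebra_simps)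
    moreover have "(- (int i * (2 * p)) + (2 * p) * int q) div int q
        = 2 * p + (- (int i * (2 * p))) div int q"
      using q by (intro div_mult_self1) auto
    ultimately show "s (q - i) = - s i"
      by (simp add: s_def sg_def)
  qed simp
  also have "\<dots> = - sum s {1..<q}" by (simp add: sum_negf)
  finally have "sum s {1..<q} = 0" by simp
  then show ?thesis
    using walk_split[OF q, of "2 * p" q] by (simp add: s_def)
qed

text \<open>Advancing \<open>i\<close> by \<open>q\<close> adds the even number \<open>2 * p\<close>
  to the floor, so the signs have period \<open>q\<close>.\<close>

lemma walk_add_period:
  assumes "q \<ge> 1"
  shows "walk (2 * p) q (t * q + n) = real t * walk (2 * p) q q + walk (2 * p) q n"
proof -
  define s where "s = (\<lambda>i. sg ((int i * (2 * p)) div int q))"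
  have per: "s (i + q) = s i" for i
  proof -
    have "int (i + q) * (2 * p) = int i * (2 * p) + (2 * p) * int q"
      by (simp add: algebra_simps)
    moreover have "\<dots> div int q = 2 * p + (int i * (2 * p)) div int q"
      using assms by (intro div_mult_self1) auto
    ultimately show ?thesis by (simp add: s_def sg_def)
  qed
  have one: "sum s {..<q + n} = sum s {..<q} + sum s {..<n}" for n
    by (induction n) (simp_all add: per add.commute)
  have "sum s {..<t * q + n} = real t * sum s {..<q} + sum s {..<n}"
  proof (induction t)
    case (Suc t)
    have "Suc t * q + n = q + (t * q + n)" by simp
    then show ?case using one[of "t * q + n"] Suc by (simp only: of_nat_Suc distrib_right)
  qed simp
  then show ?thesis by (simp add: s_def walk_def)
qed

section \<open>Comparison of a fraction with its Farey neighbours\<close>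

lemma div_mult_bounds:
  fixes a q :: int
  assumes "q > 0"
  shows "(a div q) * q \<le> a" "a < (a div q + 1) * q"
  using div_mult_mod_eq[of a q] pos_mod_sign[OF assms, of a] pos_mod_bound[OF assms, of a]
    distrib_right[of "a div q" 1 q]
  by linarith+

text \<open>
  For \<open>i < h'\<close> the points \<open>i * p1 / q\<close> and \<open>i * p' / (2 * h')\<close> lie in the same half of the circle,
  since they differ by less than \<open>1 / (2 * q)\<close> and the step function has no jump that close to the
  right of \<open>i * p1 / q\<close>.
\<close>
lemma div_right_neighbour:
  fixes p' p1 h' q i :: int
  assumes "p' * q = 2 * h' * p1 + 1" "0 \<le> i" "i < h'" "q > 0"
  shows "(i * p') div h' = (i * (2 * p1)) div q"
proof -
  define z where "z = (i * (2 * p1)) div q"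
  have z: "z * q \<le> i * (2 * p1)" "i * (2 * p1) + 1 \<le> (z + 1) * q"
    using div_mult_bounds[OF assms(4), of "i * (2 * p1)"] by (simp_all add: z_def)
  have h': "h' > 0" using assms by linarith
  have "(i * p') * q = i * (p' * q)" by simp
  also have "\<dots> = h' * (i * (2 * p1)) + i" unfolding assms(1) by (simp add: distrib_left)
  finally have e: "(i * p') * q = h' * (i * (2 * p1)) + i" .
  have "(z * h') * q = h' * (z * q)" by simp
  also have "\<dots> \<le> h' * (i * (2 * p1))" using z(1) h' by (intro mult_left_mono) auto
  also have "\<dots> \<le> (i * p') * q" using e assms(2) by linarith
  finally have lo: "z * h' \<le> i * p'" using assms(4) by (simp only: mult_le_cancel_right_pos)
  have "(i * p') * q < h' * (i * (2 * p1) + 1)"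
    using e assms(3) distrib_left[of h' "i * (2 * p1)" 1] by linarith
  also have "\<dots> \<le> h' * ((z + 1) * q)" using z(2) h' by (intro mult_left_mono) auto
  also have "\<dots> = ((z + 1) * h') * q" by simp
  finally have "i * p' < (z + 1) * h'" using assms(4) by (simp only: mult_less_cancel_right_pos)
  with lo show ?thesis
    unfolding z_def[symmetric]
    by (intro int_div_pos_eq[where r = "i * p' - z * h'"]) (auto simp: algebra_simps)
qed

text \<open>Here \<open>i * p / h\<close> exceeds \<open>i * 2 * p1 / q\<close> by
  \<open>i / (q * h) < 1 / h\<close>, so the latter lies strictly between
  \<open>(i * p - 1) / h\<close> and \<open>i * p / h\<close> and has the floor of the
  former.\<close>

lemma div_left_neighbour:
  fixes p p1 h q i :: int
  assumes "p * q = 2 * h * p1 + 1" "1 \<le> i" "i < q" "h > 0"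
  shows "(i * (2 * p1)) div q = (i * p - 1) div h"
proof -
  define z where "z = (i * p - 1) div h"
  have z: "z * h \<le> i * p - 1" "i * p \<le> (z + 1) * h"
    using div_mult_bounds[OF assms(4), of "i * p - 1"] by (simp_all add: z_def)
  have q: "q > 0" using assms by linarith
  have "(i * p) * q = i * (p * q)" by simp
  also have "\<dots> = h * (i * (2 * p1)) + i" unfolding assms(1) by (simp add: distrib_left)
  finally have e: "(i * p) * q = h * (i * (2 * p1)) + i" .
  have "h * (z * q) = (z * h) * q" by simp
  also have "\<dots> \<le> (i * p - 1) * q" using z(1) q by (intro mult_right_mono) auto
  also have "\<dots> \<le> h * (i * (2 * p1))"
    using e assms(3) left_diff_distrib[of "i * p" 1 q] by linarith
  finally have lo: "z * q \<le> i * (2 * p1)" using assms(4) by (simp only: mult_le_cancel_left_pos)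
  have "h * (i * (2 * p1)) < (i * p) * q" using e assms(2) by linarith
  also have "\<dots> \<le> ((z + 1) * h) * q" using z(2) q by (intro mult_right_mono) auto
  also have "\<dots> = h * ((z + 1) * q)" by simp
  finally have "i * (2 * p1) < (z + 1) * q" using assms(4) by (simp only: mult_less_cancel_left_pos)
  with lo show ?thesis
    unfolding z_def[symmetric]
    by (intro int_div_pos_eq[where r = "i * (2 * p1) - z * q"]) (auto simp: algebra_simps)
qed

section \<open>The step that raises the maximum\<close>

text \<open>Since \<open>p' * q = 2 * h' * p1 + 1\<close>, the fraction \<open>p1 / q\<close> is a
  left neighbour of the new fraction too, and the new walk up to \<open>h'\<close> is that of
  \<open>p1 / q\<close>: it gains 1 per period \<open>q\<close> and deviates within a period as the
  old walk met from the left.\<close>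

lemma walk_up:
  assumes hub: "hub p h"
    and bd: "\<forall>n\<in>{1..h}. m \<le> walk p h n \<and> walk p h n \<le> M"
    and q: "p * int q = 2 * int h * p1 + 1" "q \<ge> 1" and A: "A \<ge> 1"
  defines "h' \<equiv> A * q + h" and "p' \<equiv> 2 * int A * p1 + p"
  shows "hub p' h'"
    and "\<And>n. 1 \<le> n \<Longrightarrow> n \<le> h' \<Longrightarrow> m \<le> walk p' h' n"
    and "\<And>n t. 1 \<le> n \<Longrightarrow> n \<le> h' \<Longrightarrow> n \<le> (t + 1) * q \<Longrightarrow> walk p' h' n \<le> real t + M + 1"
    and "walk p' h' (A * q) = real A"
proof -
  have h: "h \<ge> 1" using hub by (simp add: hub_def)
  have q': "p' * int q = 2 * int h' * p1 + 1"
    using q(1) by (simp add: h'_def p'_def algebra_simps)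
  have "coprime p' (2 * int h')"
  proof (rule coprimeI)
    fix c assume "c dvd p'" "c dvd 2 * int h'"
    then have "c dvd p' * int q" "c dvd 2 * int h' * p1" by auto
    then show "is_unit c" using q' by (metis dvd_add_right_iff)
  qed
  then show "hub p' h'" using h by (simp add: hub_def h'_def)
  have "odd (p * int q)" using q(1) by simp
  then have "odd q" by simp
  have "coprime p1 (int q)"
  proof (rule coprimeI)
    fix c assume "c dvd p1" "c dvd int q"
    then have "c dvd p * int q" "c dvd 2 * int h * p1" by auto
    then show "is_unit c" using q by (metis dvd_add_right_iff)
  qed
  note wq = walk_period_odd[OF q(2) this \<open>odd q\<close>]
  have w: "walk p' h' n = walk (2 * p1) q n" if "n \<le> h'" for n
    unfolding walk_def
  proof (rule sum.cong)
    fix i assume "i \<in> {..<n}"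
    then show "sg (int i * p' div int h') = sg (int i * (2 * p1) div int q)"
      using that q(2) by (subst div_right_neighbour[OF q']) auto
  qed simp
  have wt: "walk (2 * p1) q (t * q + n) = real t + walk (2 * p1) q n" for t n
    using walk_add_period[OF q(2), of p1 t n] wq by simp
  show "walk p' h' (A * q) = real A"
    using w[of "A * q"] wt[of A 0] by (simp add: h'_def walk_def)
  have b: "m \<le> walk (2 * p1) q n \<and> walk (2 * p1) q n \<le> M + 1" if "1 \<le> n" "n \<le> q" for n
  proof -
    have "(\<Sum>i\<in>{1..<n}. sg (int i * (2 * p1) div int q)) = (\<Sum>i\<in>{1..<n}. sg ((int i * p - 1) div int h))"
    proof (rule sum.cong)
      fix i assume "i \<in> {1..<n}"
      then show "sg (int i * (2 * p1) div int q) = sg ((int i * p - 1) div int h)"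
        using that h by (subst div_left_neighbour[OF q(1)]) auto
    qed simp
    then show ?thesis
      using walk_left_neighbour_bounds[OF hub bd that(1)] walk_split[OF that(1)] by simp
  qed
  \<comment> \<open>The remainder is taken in \<open>1..q\<close>, not \<open>0..q-1\<close>,
    because \<open>b\<close> does not cover the empty sum.\<close>
  have decomp: "\<exists>t s. n = t * q + s \<and> 1 \<le> s \<and> s \<le> q" if "1 \<le> n" for n
  proof -
    have "n = ((n - 1) div q) * q + ((n - 1) mod q + 1)"
      using that by simp
    moreover have "(n - 1) mod q + 1 \<le> q"
      using q(2) by (simp add: Suc_leI)
    ultimately show ?thesis by (metis le_add2)
  qed
  show "m \<le> walk p' h' n" if n: "1 \<le> n" "n \<le> h'" for n
  proof -
    obtain t s where "n = t * q + s" "1 \<le> s" "s \<le> q" using decomp[OF n(1)] by blast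
    then show ?thesis using w[OF n(2)] wt[of t s] b[of s] by simp
  qed
  show "walk p' h' n \<le> real t + M + 1" if n: "1 \<le> n" "n \<le> h'" "n \<le> (t + 1) * q" for n t
  proof -
    obtain u s where us: "n = u * q + s" "1 \<le> s" "s \<le> q" using decomp[OF n(1)] by blast
    then have "u * q < (t + 1) * q" using n(3) by linarith
    then have "u < t + 1" by (simp only: mult_less_cancel2)
    then have "real u \<le> real t" by simp
    then show ?thesis using w[OF n(2)] wt[of u s] b[of s] us by simp
  qed
qed

text \<open>The inverses of \<open>p\<close> modulo \<open>2 * h\<close> form a residue class, which
  has arbitrarily large members.\<close>

lemma hub_left_neighbour_exists:
  assumes "hub p h"
  shows "\<exists>q p1. q \<ge> N \<and> q \<ge> 1 \<and> p * int q = 2 * int h * p1 + 1"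
proof -
  obtain u v where uv: "u * p + v * (2 * int h) = 1"
    using assms bezout_int[of p "2 * int h"] by (auto simp: hub_def)
  define T where "T = \<bar>u\<bar> + int N + 1"
  define w where "w = u + 2 * int h * T"
  have "1 * T \<le> 2 * int h * T"
    using assms by (intro mult_right_mono) (auto simp: hub_def T_def)
  then have "u + T \<le> w" unfolding w_def by linarith
  then have w: "w \<ge> int N + 1" unfolding T_def by linarith
  have "p * w = 2 * int h * (p * T - v) + (u * p + v * (2 * int h))"
    by (simp add: w_def algebra_simps)
  with w uv show ?thesis
    by (intro exI[of _ "nat w"] exI[of _ "p * T - v"]) auto
qed

text \<open>Both centres lie to the right of \<open>p1 / q\<close>, at distance at most
  \<open>1 / (2 * h * q) \<le> 1 / (4 * h^2)\<close>. The new radius is at most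
  \<open>1 / (8 * h^2)\<close>, and the sum stays below \<open>1 / (2 * h^2)\<close>.\<close>

lemma near_nested:
  assumes q: "p * int q = 2 * int h * p1 + 1" "q \<ge> 2 * h" and h: "h \<ge> 1" and A: "A \<ge> 1"
  defines "h' \<equiv> A * q + h" and "p' \<equiv> 2 * int A * p1 + p"
  shows "near p' h' \<subseteq> near p h"
proof -
  have q0: "real q > 0" "real h > 0" using q h by auto
  have h'q: "h' \<ge> q" using A by (simp add: h'_def trans_le_add1)
  then have h'0: "real h' > 0" using q0 by linarith
  have q': "p' * int q = 2 * int h' * p1 + 1"
    using q(1) by (simp add: h'_def p'_def algebra_simps)
  have r: "real_of_int p * real q = 2 * real h * real_of_int p1 + 1"
    using arg_cong[OF q(1), of real_of_int] by simp
  have r': "real_of_int p' * real q = 2 * real h' * real_of_int p1 + 1"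
    using arg_cong[OF q', of real_of_int] by simp
  have e: "of_int p / (2 * real h) = of_int p1 / real q + 1 / (2 * real h * real q)"
    using r q0 by (simp add: field_simps)
  have e': "of_int p' / (2 * real h') = of_int p1 / real q + 1 / (2 * real h' * real q)"
    using r' q0 h'0 by (simp add: field_simps)
  have hh: "real h \<le> real h'" "2 * real h \<le> real h'" "2 * real h \<le> real q"
    using q(2) h'q by auto
  have "1 / (2 * real h' * real q) \<le> 1 / (2 * real h * real q)"
    using hh q0 h'0 by (intro divide_left_mono mult_mono) auto
  moreover have "0 \<le> 1 / (2 * real h' * real q)" by simp
  moreover have "1 / (2 * real h * real q) \<le> 1 / (2 * real h * (2 * real h))"
    using hh q0 by (intro divide_left_mono mult_mono) auto
  moreover have "1 / (2 * (real h')\<^sup>2) \<le> 1 / (2 * (2 * real h)\<^sup>2)"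
    using hh q0 h'0 by (intro divide_left_mono mult_mono power_mono) auto
  moreover have "1 / (2 * real h * (2 * real h)) + 1 / (2 * (2 * real h)\<^sup>2) \<le> 1 / (2 * (real h)\<^sup>2)"
    using q0 by (simp add: power2_eq_square field_simps)
  ultimately have "\<bar>of_int p' / (2 * real h') - of_int p / (2 * real h)\<bar> + 1 / (2 * (real h')\<^sup>2)
      \<le> 1 / (2 * (real h)\<^sup>2)"
    unfolding e e' by linarith
  then show ?thesis
    by (simp add: near_def cball_subset_cball_iff dist_real_def)
qed

text \<open>The walk of \<open>p1 / q\<close> gains \<open>1 / q\<close> per unit of time on average
  while \<open>c\<close> is sublinear, so it catches up with \<open>c\<close>; stopping at the first
  period where this happens limits the overshoot after the first period to 1.\<close>

lemma up_step:
  assumes hub: "hub p h"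
    and bd: "\<forall>n\<in>{1..h}. m \<le> walk p h n \<and> walk p h n \<le> M"
    and inc: "incseq c" and div: "filterlim c at_top sequentially"
    and small: "\<And>\<epsilon>. \<epsilon> > 0 \<Longrightarrow> eventually (\<lambda>n. c n \<le> \<epsilon> * real n) sequentially"
    and \<epsilon>: "\<epsilon> > (0 :: real)"
  shows "\<exists>p' h'. hub p' h' \<and> 2 * h \<le> h' \<and> near p' h' \<subseteq> near p h
    \<and> (\<forall>n\<in>{1..h'}. m \<le> walk p' h' n \<and> walk p' h' n \<le> c h' + 1)
    \<and> (\<forall>n\<in>{h..h'}. walk p' h' n \<le> max (M + 1) (c n + 1))
    \<and> (\<exists>n\<in>{h..h'}. (1 - \<epsilon>) * c n \<le> walk p' h' n)"
proof -
  have h: "h \<ge> 1" using hub by (simp add: hub_def)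
  have M: "M \<ge> 1" using bspec[OF bd, of 1] walk_1[OF hub] h by simp
  \<comment> \<open>The bound \<open>M + 3\<close> will rule out \<open>A = 1\<close>; the bound
    \<open>(M + 1) / \<epsilon>\<close> makes the additive error \<open>M + 1\<close> at most
    \<open>\<epsilon> * c n\<close> at time \<open>n = A * q\<close>.\<close>
  have "eventually (\<lambda>n. c n \<ge> max (M + 3) ((M + 1) / \<epsilon>)) sequentially"
    using div unfolding filterlim_at_top by blast
  then obtain N where N: "c N \<ge> M + 3" "c N \<ge> (M + 1) / \<epsilon>"
    by (auto simp: eventually_sequentially)
  obtain q p1 where q: "q \<ge> max N (2 * h)" "q \<ge> 1" "p * int q = 2 * int h * p1 + 1"
    using hub_left_neighbour_exists[OF hub] by blast
  have mono: "c i \<le> c j" if "i \<le> j" for i j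
    using inc that by (simp add: incseq_def)
  define X where "X = (\<lambda>A. c (A * q) \<le> real A + M + 1)"
  \<comment> \<open>Once \<open>c n \<le> n / q\<close>, the gain of 1 per period already reaches
    \<open>c\<close>.\<close>
  have "\<exists>A\<ge>1. X A"
  proof -
    obtain n0 where n0: "\<And>n. n \<ge> n0 \<Longrightarrow> c n \<le> (1 / real q) * real n"
      using small[of "1 / real q"] q(2) by (auto simp: eventually_sequentially)
    have "Suc n0 * q \<ge> n0" using q(2) by (simp add: trans_le_add2 Suc_leI)
    from n0[OF this] have "c (Suc n0 * q) \<le> real (Suc n0)" using q(2) by (simp del: mult_Suc)
    then have "X (Suc n0)" using M by (simp add: X_def)
    then show ?thesis by (intro exI[of _ "Suc n0"]) simp
  qed
  then obtain A where A: "A \<ge> 1" "X A" and least: "\<And>t. 1 \<le> t \<Longrightarrow> t < A \<Longrightarrow> \<not> X t"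
    using exists_least_iff[of "\<lambda>A. A \<ge> 1 \<and> X A"] by blast
  have "c N \<le> c (1 * q)" using q(1) by (intro mono) simp
  then have "\<not> X 1" using N(1) by (simp add: X_def)
  then have A2: "A \<ge> 2" using A by (cases "A = 1") auto
  have cross: "real t + M + 1 < c (t * q)" if "1 \<le> t" "t < A" for t
    using least[OF that] by (simp add: X_def)
  define h' where "h' = A * q + h"
  define p' where "p' = 2 * int A * p1 + p"
  note up = walk_up[OF hub bd q(3,2) A(1), folded h'_def p'_def]
  have hq: "2 * h \<le> q" using q(1) by simp
  have Aq: "q \<le> A * q" using A(1) by simp
  have "near p' h' \<subseteq> near p h"
    unfolding h'_def p'_def using q(3) hq h A(1) by (rule near_nested)
  moreover have "2 * h \<le> h'" unfolding h'_def using hq Aq by linarith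
  moreover have "\<forall>n\<in>{1..h'}. m \<le> walk p' h' n \<and> walk p' h' n \<le> c h' + 1"
  proof
    fix n assume n: "n \<in> {1..h'}"
    then have "n \<le> (A + 1) * q" using hq by (simp add: h'_def)
    then have "walk p' h' n \<le> real A + M + 1" using n up(3)[of n A] by simp
    \<comment> \<open>Minimality of \<open>A\<close> is applied one period earlier, which costs
      1.\<close>
    also have "\<dots> \<le> c ((A - 1) * q) + 1"
      using cross[of "A - 1"] A2 by (simp add: of_nat_diff less_imp_le)
    also have "c ((A - 1) * q) \<le> c h'"
      by (intro mono) (simp add: h'_def trans_le_add1)
    finally show "m \<le> walk p' h' n \<and> walk p' h' n \<le> c h' + 1" using up(2)[of n] n by simp
  qed
  moreover have "\<forall>n\<in>{h..h'}. walk p' h' n \<le> max (M + 1) (c n + 1)"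
  proof
    fix n assume n: "n \<in> {h..h'}"
    then have n1: "1 \<le> n" "n \<le> h'" using h by auto
    define t where "t = (n - 1) div q"
    have tq: "t * q < n" "n \<le> (t + 1) * q"
    proof -
      have "n - 1 = t * q + (n - 1) mod q" by (simp add: t_def)
      moreover have "(n - 1) mod q < q" using q(2) by simp
      ultimately show "t * q < n" "n \<le> (t + 1) * q" using n1(1) by (simp_all add: algebra_simps)
    qed
    have wt: "walk p' h' n \<le> real t + M + 1" using up(3)[OF n1 tq(2)] .
    show "walk p' h' n \<le> max (M + 1) (c n + 1)"
    proof (cases "t = 0")
      case True
      then show ?thesis using wt by simp
    next
      case False
      have "t * q < (A + 1) * q" using tq(1) n1(2) hq q(2) by (simp add: h'_def)
      then have "t < A + 1" by (simp only: mult_less_cancel2)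
      \<comment> \<open>The index \<open>t\<close> may equal \<open>A\<close>, where minimality says
        nothing; going back to \<open>A - 1\<close> loses at most 1.\<close>
      define s where "s = min t (A - 1)"
      have s: "1 \<le> s" "s < A" "t \<le> s + 1" "s \<le> t"
        using False A2 \<open>t < A + 1\<close> by (auto simp: s_def)
      have "s * q \<le> n" using tq(1) mult_le_mono1[OF s(4), of q] by linarith
      then have "real s + M + 1 < c n" using cross[OF s(1,2)] mono by fastforce
      moreover have "real t \<le> real s + 1" using s(3) by linarith
      ultimately show ?thesis using wt by simp
    qed
  qed
  moreover have "\<exists>n\<in>{h..h'}. (1 - \<epsilon>) * c n \<le> walk p' h' n"
  proof
    show "A * q \<in> {h..h'}"
      unfolding h'_def atLeastAtMost_iff using hq Aq by linarith
    have "N \<le> A * q" using q(1) Aq by linarith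
    then have "(M + 1) / \<epsilon> \<le> c (A * q)" using N(2) mono order_trans by blast
    then have "M + 1 \<le> \<epsilon> * c (A * q)" using \<epsilon> by (simp add: pos_divide_le_eq mult.commute)
    then show "(1 - \<epsilon>) * c (A * q) \<le> walk p' h' (A * q)"
      using A(2) up(4) by (simp add: X_def algebra_simps)
  qed
  ultimately show ?thesis using up(1) by blast
qed

section \<open>Refinement in both directions with a fixed additive constant\<close>

text \<open>The lower bound concerns \<open>2 - walk\<close>, the walk of \<open>- p\<close>, so
  that reflection just swaps \<open>c\<close> and \<open>d\<close>. Only the final values
  \<open>c h\<close> and \<open>d h\<close> enter; bounds at each time come from
  \<open>refines\<close>.\<close>

definition bounded_hub :: "(nat \<Rightarrow> real) \<Rightarrow> (nat \<Rightarrow> real) \<Rightarrow> real \<Rightarrow> int \<Rightarrow> nat \<Rightarrow> bool" where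
  "bounded_hub c d K p h \<longleftrightarrow> hub p h \<and> (\<forall>n\<in>{1..h}. walk p h n \<le> c h + K \<and> 2 - walk p h n \<le> d h + K)"

definition refines ::
    "(nat \<Rightarrow> real) \<Rightarrow> (nat \<Rightarrow> real) \<Rightarrow> real \<Rightarrow> int \<Rightarrow> nat \<Rightarrow> int \<Rightarrow> nat \<Rightarrow> bool" where
  "refines c d K p h p' h' \<longleftrightarrow> 2 * h \<le> h' \<and> near p' h' \<subseteq> near p h
    \<and> (\<forall>n\<in>{h..h'}. walk p' h' n \<le> c n + K + 1 \<and> 2 - walk p' h' n \<le> d n + K + 1)"

text \<open>This is \<open>up_step\<close> with \<open>M = c h + K\<close> and
  \<open>m = 2 - d h - K\<close>. The new bounds \<open>c h' + 1\<close> and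
  \<open>2 - d h - K\<close> have the same form with the same \<open>K\<close>, so errors do not
  accumulate over the stages.\<close>

lemma refine_up:
  assumes bh: "bounded_hub c d K p h"
    and inc: "incseq c" "incseq d" and div: "filterlim c at_top sequentially"
    and small: "\<And>\<epsilon>. \<epsilon> > 0 \<Longrightarrow> eventually (\<lambda>n. c n \<le> \<epsilon> * real n) sequentially"
    and \<epsilon>: "\<epsilon> > (0 :: real)" and K: "K \<ge> 1"
  shows "\<exists>p' h'. bounded_hub c d K p' h' \<and> refines c d K p h p' h'
    \<and> (\<exists>n\<in>{h..h'}. (1 - \<epsilon>) * c n \<le> walk p' h' n)"
proof -
  have bd: "\<forall>n\<in>{1..h}. 2 - d h - K \<le> walk p h n \<and> walk p h n \<le> c h + K"
    using bh by (force simp: bounded_hub_def)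
  have hub: "hub p h" using bh by (simp add: bounded_hub_def)
  then have h: "h \<ge> 1" by (simp add: hub_def)
  obtain p' h' where *: "hub p' h'" "2 * h \<le> h'" "near p' h' \<subseteq> near p h"
      "\<And>n. n \<in> {1..h'} \<Longrightarrow> 2 - d h - K \<le> walk p' h' n \<and> walk p' h' n \<le> c h' + 1"
      "\<And>n. n \<in> {h..h'} \<Longrightarrow> walk p' h' n \<le> max (c h + K + 1) (c n + 1)"
      "\<exists>n\<in>{h..h'}. (1 - \<epsilon>) * c n \<le> walk p' h' n"
    using up_step[OF hub bd inc(1) div small \<epsilon>] by blast
  have mono: "c h \<le> c n" "d h \<le> d n" if "h \<le> n" for n
    using inc that by (simp_all add: incseq_def)
  have "bounded_hub c d K p' h'"
    using *(1,2,4) mono(2)[of h'] K by (force simp: bounded_hub_def)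
  moreover have "refines c d K p h p' h'"
    unfolding refines_def
  proof (intro conjI ballI)
    fix n assume n: "n \<in> {h..h'}"
    with h have "n \<in> {1..h'}" by simp
    then show "2 - walk p' h' n \<le> d n + K + 1" using *(4)[of n] mono(2)[of n] n by simp
    show "walk p' h' n \<le> c n + K + 1" using *(5)[OF n] mono(1)[of n] n K by simp
  qed (use * in auto)
  ultimately show ?thesis using *(6) by blast
qed

lemma near_uminus: "\<theta> \<in> near (- p) h \<longleftrightarrow> - \<theta> \<in> near p h"
  by (simp add: near_def dist_real_def) (simp add: abs_minus_commute add.commute)

lemma bounded_hub_uminus: "bounded_hub c d K (- p) h \<longleftrightarrow> bounded_hub d c K p h"
proof (cases "hub p h")
  case True
  have "(\<forall>n\<in>{1..h}. walk (- p) h n \<le> c h + K \<and> 2 - walk (- p) h n \<le> d h + K)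
      \<longleftrightarrow> (\<forall>n\<in>{1..h}. walk p h n \<le> d h + K \<and> 2 - walk p h n \<le> c h + K)"
  proof (intro ball_cong refl)
    fix n assume "n \<in> {1..h}"
    then have "walk (- p) h n = 2 - walk p h n" using True by (simp add: walk_uminus)
    then show "(walk (- p) h n \<le> c h + K \<and> 2 - walk (- p) h n \<le> d h + K)
        = (walk p h n \<le> d h + K \<and> 2 - walk p h n \<le> c h + K)"
      by auto
  qed
  with True show ?thesis by (simp add: bounded_hub_def hub_uminus)
qed (simp add: bounded_hub_def hub_uminus)

lemma refines_uminus:
  assumes "hub p h" "hub p' h'"
  shows "refines c d K (- p) h (- p') h' \<longleftrightarrow> refines d c K p h p' h'"
proof -
  have "near (- p') h' \<subseteq> near (- p) h \<longleftrightarrow> near p' h' \<subseteq> near p h"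
  proof (intro iffI subsetI)
    fix \<theta> assume "near (- p') h' \<subseteq> near (- p) h" "\<theta> \<in> near p' h'"
    then have "- \<theta> \<in> near (- p) h" using near_uminus[of "- \<theta>" p' h'] by auto
    then show "\<theta> \<in> near p h" using near_uminus[of "- \<theta>" p h] by simp
  next
    fix \<theta> assume "near p' h' \<subseteq> near p h" "\<theta> \<in> near (- p') h'"
    then show "\<theta> \<in> near (- p) h" by (auto simp: near_uminus)
  qed
  moreover have "(\<forall>n\<in>{h..h'}. walk (- p') h' n \<le> c n + K + 1 \<and> 2 - walk (- p') h' n \<le> d n + K + 1)
      \<longleftrightarrow> (\<forall>n\<in>{h..h'}. walk p' h' n \<le> d n + K + 1 \<and> 2 - walk p' h' n \<le> c n + K + 1)"
  proof (intro ball_cong refl)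
    fix n assume "n \<in> {h..h'}"
    then have "walk (- p') h' n = 2 - walk p' h' n"
      using assms by (simp add: walk_uminus hub_def)
    then show "(walk (- p') h' n \<le> c n + K + 1 \<and> 2 - walk (- p') h' n \<le> d n + K + 1)
        = (walk p' h' n \<le> d n + K + 1 \<and> 2 - walk p' h' n \<le> c n + K + 1)"
      by auto
  qed
  ultimately show ?thesis unfolding refines_def by blast
qed

text \<open>Apply \<open>refine_up\<close> to \<open>- p\<close> with \<open>c\<close> and
  \<open>d\<close> exchanged, then reflect back.\<close>

lemma refine_down:
  assumes bh: "bounded_hub c d K p h"
    and inc: "incseq c" "incseq d" and div: "filterlim d at_top sequentially"
    and small: "\<And>\<epsilon>. \<epsilon> > 0 \<Longrightarrow> eventually (\<lambda>n. d n \<le> \<epsilon> * real n) sequentially"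
    and \<epsilon>: "\<epsilon> > (0 :: real)" and K: "K \<ge> 1"
  shows "\<exists>p' h'. bounded_hub c d K p' h' \<and> refines c d K p h p' h'
    \<and> (\<exists>n\<in>{h..h'}. (1 - \<epsilon>) * d n \<le> 2 - walk p' h' n)"
proof -
  obtain p' h' n where *: "bounded_hub d c K p' h'" "refines d c K (- p) h p' h'"
      "n \<in> {h..h'}" "(1 - \<epsilon>) * d n \<le> walk p' h' n"
    using refine_up[OF _ inc(2,1) div small \<epsilon> K, of "- p" h] bh bounded_hub_uminus by blast
  have hubs: "hub p h" "hub p' h'" using bh * by (auto simp: bounded_hub_def)
  have "bounded_hub c d K (- p') h'" using * by (simp add: bounded_hub_uminus)
  moreover have "refines c d K p h (- p') h'"
    using refines_uminus[of "- p" h p' h' c d K] * hubs by (simp add: hub_uminus)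
  moreover have "1 \<le> n" "n \<le> h'" using * hubs by (auto simp: hub_def)
  ultimately show ?thesis using * walk_uminus[OF hubs(2), of n] by force
qed

section \<open>The limit of the alternating construction\<close>

text \<open>The nested compact intervals \<open>near\<close> have a common point
  \<open>\<theta>\<close>. As \<open>h k\<close> tends to infinity, \<open>\<theta>\<close> is
  irrational and each of its sums is a sum of some stage.\<close>

lemma exists_theta:
  assumes hub: "hub p0 h0"
    and c: "\<And>n. c n > 0" "incseq c" "\<And>\<epsilon>. \<epsilon> > 0 \<Longrightarrow> eventually (\<lambda>n. c n \<le> \<epsilon> * real n) sequentially"
    and d: "\<And>n. d n > 0" "incseq d" "\<And>\<epsilon>. \<epsilon> > 0 \<Longrightarrow> eventually (\<lambda>n. d n \<le> \<epsilon> * real n) sequentially"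
    and div: "filterlim c at_top sequentially \<or> filterlim d at_top sequentially"
  shows "\<exists>\<theta> K. \<theta> \<in> near p0 h0 \<and> \<theta> \<notin> \<rat>
    \<and> (\<forall>n\<ge>1. erg_sum \<theta> n 0 \<le> c n + K \<and> - erg_sum \<theta> n 0 \<le> d n + K)
    \<and> (filterlim c at_top sequentially \<longrightarrow>
        (\<forall>k. \<exists>n\<ge>k. n \<ge> 1 \<and> (1 - 1 / real (Suc k)) * c n \<le> erg_sum \<theta> n 0))
    \<and> (filterlim d at_top sequentially \<longrightarrow>
        (\<forall>k. \<exists>n\<ge>k. n \<ge> 1 \<and> (1 - 1 / real (Suc k)) * d n \<le> 2 - erg_sum \<theta> n 0))"
proof -
  have walk_le: "\<bar>walk p h n\<bar> \<le> real n" for p h n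
  proof -
    have "\<bar>walk p h n\<bar> \<le> (\<Sum>i<n. \<bar>sg ((int i * p) div int h)\<bar>)"
      unfolding walk_def by (rule sum_abs)
    also have "\<dots> = real n" by (simp add: sg_bounds)
    finally show ?thesis .
  qed
  \<comment> \<open>Sums up to time \<open>h0\<close> are at most \<open>h0\<close> in absolute
    value, so this \<open>K\<close> makes the initial fraction admissible, also for
    \<open>2 - walk\<close>.\<close>
  define K where "K = real h0 + 3"
  have K1: "K \<ge> 1" by (simp add: K_def)
  have init: "bounded_hub c d K p0 h0"
    unfolding bounded_hub_def
  proof (intro conjI ballI)
    fix n assume "n \<in> {1..h0}"
    then have "\<bar>walk p0 h0 n\<bar> \<le> real h0" using walk_le[of p0 h0 n] by simp
    then show "walk p0 h0 n \<le> c h0 + K" "2 - walk p0 h0 n \<le> d h0 + K"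
      using c(1)[of h0] d(1)[of h0] by (auto simp: K_def)
  qed (rule hub)
  define good where "good = (\<lambda>(k :: nat) (p :: int) (h :: nat) p' h'.
      (even k \<and> filterlim c at_top sequentially \<longrightarrow>
        (\<exists>n\<in>{h..h'}. (1 - 1 / real (Suc k)) * c n \<le> walk p' h' n)) \<and>
      (odd k \<and> filterlim d at_top sequentially \<longrightarrow>
        (\<exists>n\<in>{h..h'}. (1 - 1 / real (Suc k)) * d n \<le> 2 - walk p' h' n)))"
  have ex: "\<exists>p' h'. bounded_hub c d K p' h' \<and> refines c d K p h p' h' \<and> good k p h p' h'"
    if bh: "bounded_hub c d K p h" for p h k
  proof -
    have \<epsilon>: "1 / real (Suc k) > 0" by simp
    \<comment> \<open>If only one sequence diverges, its step is taken at every stage, and what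
      \<open>good\<close> asks about the other one is vacuous.\<close>
    consider "filterlim c at_top sequentially" "even k \<or> \<not> filterlim d at_top sequentially"
      | "filterlim d at_top sequentially" "odd k \<or> \<not> filterlim c at_top sequentially"
      using div by blast
    then show ?thesis
    proof cases
      case 1
      then show ?thesis
        using refine_up[OF bh c(2) d(2) 1(1) c(3) \<epsilon> K1] unfolding good_def by blast
    next
      case 2
      then show ?thesis
        using refine_down[OF bh c(2) d(2) 2(1) d(3) \<epsilon> K1] unfolding good_def by blast
    qed
  qed
  have "\<exists>f. \<forall>k. (bounded_hub c d K (fst (f k)) (snd (f k)) \<and> (k = 0 \<longrightarrow> f k = (p0, h0)))
      \<and> (refines c d K (fst (f k)) (snd (f k)) (fst (f (Suc k))) (snd (f (Suc k)))
        \<and> good k (fst (f k)) (snd (f k)) (fst (f (Suc k))) (snd (f (Suc k))))"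
  proof (rule dependent_nat_choice, goal_cases)
    case 1
    then show ?case using init by (intro exI[of _ "(p0, h0)"]) simp
  next
    case (2 x k)
    then show ?case using ex[of "fst x" "snd x" k] by force
  qed
  then obtain f where f: "\<And>k. bounded_hub c d K (fst (f k)) (snd (f k))" "f 0 = (p0, h0)"
    "\<And>k. refines c d K (fst (f k)) (snd (f k)) (fst (f (Suc k))) (snd (f (Suc k)))"
    "\<And>k. good k (fst (f k)) (snd (f k)) (fst (f (Suc k))) (snd (f (Suc k)))"
    by blast
  define p h where "p = (\<lambda>k. fst (f k))" and "h = (\<lambda>k. snd (f k))"
  have hubs: "hub (p k) (h k)" for k
    using f(1) by (simp add: bounded_hub_def p_def h_def)
  have p0: "p 0 = p0" "h 0 = h0" using f(2) by (auto simp: p_def h_def)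
  have ref: "refines c d K (p k) (h k) (p (Suc k)) (h (Suc k))" for k
    using f(3) by (simp add: p_def h_def)
  have good: "good k (p k) (h k) (p (Suc k)) (h (Suc k))" for k
    using f(4) by (simp add: p_def h_def)
  have h1: "h k \<ge> 1" for k using hubs by (simp add: hub_def)
  have hk: "h k \<ge> Suc k" for k
  proof (induction k)
    case (Suc k)
    then show ?case using ref[of k] by (auto simp: refines_def)
  qed (rule h1[simplified])
  have "\<exists>\<theta>. \<forall>k. \<theta> \<in> near (p k) (h k)"
  proof -
    have "near (p (Suc k)) (h (Suc k)) \<subseteq> near (p k) (h k)" for k
      using ref by (simp add: refines_def)
    then have nested: "near (p n) (h n) \<subseteq> near (p m) (h m)" if "m \<le> n" for m n
      using lift_Suc_antimono_le[of "\<lambda>k. near (p k) (h k)" m n] that by blast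
    have "closed (near (p k) (h k))" "near (p k) (h k) \<noteq> {}" "bounded (near (p k) (h k))" for k
      by (simp_all add: near_def)
    then obtain \<theta> where "\<And>k. \<theta> \<in> near (p k) (h k)"
      using bounded_closed_nest[of "\<lambda>k. near (p k) (h k)"] nested by blast
    then show ?thesis by blast
  qed
  then obtain \<theta> where \<theta>: "\<And>k. \<theta> \<in> near (p k) (h k)" by blast
  have erg: "erg_sum \<theta> n 0 = walk (p k) (h k) n" if "n \<le> h k" for n k
    using erg_sum_near[OF hubs \<theta> that] .
  have irr: "\<theta> \<notin> \<rat>"
    using hubs \<theta> hk Suc_le_eq by (intro irrational_of_near) blast
  \<comment> \<open>Induction on the stage: the times from \<open>h k\<close> to
    \<open>h (Suc k)\<close> are governed by the passage from stage \<open>k\<close> to the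
    next.\<close>
  have bnd: "erg_sum \<theta> n 0 \<le> c n + (K + 1) \<and> 2 - erg_sum \<theta> n 0 \<le> d n + (K + 1)"
    if "h0 \<le> n" "n \<le> h k" for n k
    using that
  proof (induction k)
    case 0
    then have "n = h0" using p0 by simp
    then show ?case using f(1)[of 0] f(2) erg[of n 0] p0 hubs[of 0] by (force simp: bounded_hub_def hub_def)
  next
    case (Suc k)
    show ?case
    proof (cases "n \<le> h k")
      case True
      then show ?thesis using Suc by blast
    next
      case False
      then have "n \<in> {h k..h (Suc k)}" using Suc.prems by simp
      then show ?thesis
        using ref[of k] erg[OF Suc.prems(2)] by (simp add: refines_def add.assoc)
    qed
  qed
  have bnd': "erg_sum \<theta> n 0 \<le> c n + (K + 1) \<and> - erg_sum \<theta> n 0 \<le> d n + (K + 1)" for n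
  proof (cases "h0 \<le> n")
    case True
    have "n \<le> h n" using hk[of n] by simp
    from bnd[OF True this] show ?thesis by simp
  next
    case False
    then have "n \<le> h 0" using p0 by simp
    then have "\<bar>erg_sum \<theta> n 0\<bar> \<le> real h0"
      using erg[of n 0] walk_le[of "p 0" "h 0" n] False by simp
    then show ?thesis using c(1)[of n] d(1)[of n] by (auto simp: K_def)
  qed
  \<comment> \<open>Stage \<open>2 * k\<close> is an upward one; its times are at least
    \<open>k\<close> and its relative error is at most \<open>1 / (k + 1)\<close>.\<close>
  have up: "\<exists>n\<ge>k. n \<ge> 1 \<and> (1 - 1 / real (Suc k)) * c n \<le> erg_sum \<theta> n 0"
    if top: "filterlim c at_top sequentially" for k
  proof -
    obtain n where n: "n \<in> {h (2 * k)..h (Suc (2 * k))}"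
        "(1 - 1 / real (Suc (2 * k))) * c n \<le> walk (p (Suc (2 * k))) (h (Suc (2 * k))) n"
      using good[of "2 * k"] top by (auto simp: good_def)
    have "(1 - 1 / real (Suc k)) * c n \<le> (1 - 1 / real (Suc (2 * k))) * c n"
      using c(1)[of n] by (intro mult_right_mono diff_mono divide_left_mono) auto
    with n hk[of "2 * k"] erg[of n "Suc (2 * k)"] show ?thesis by (intro exI[of _ n]) auto
  qed
  have down: "\<exists>n\<ge>k. n \<ge> 1 \<and> (1 - 1 / real (Suc k)) * d n \<le> 2 - erg_sum \<theta> n 0"
    if top: "filterlim d at_top sequentially" for k
  proof -
    define j where "j = Suc (2 * k)"
    have "odd j" "k \<le> j" by (simp_all add: j_def)
    then obtain n where n: "n \<in> {h j..h (Suc j)}"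
        "(1 - 1 / real (Suc j)) * d n \<le> 2 - walk (p (Suc j)) (h (Suc j)) n"
      using good[of j] top by (auto simp: good_def)
    have "(1 - 1 / real (Suc k)) * d n \<le> (1 - 1 / real (Suc j)) * d n"
      using d(1)[of n] \<open>k \<le> j\<close> by (intro mult_right_mono diff_mono divide_left_mono) auto
    with n hk[of j] \<open>k \<le> j\<close> erg[of n "Suc j"] show ?thesis by (intro exI[of _ n]) auto
  qed
  show ?thesis
    using \<theta>[of 0] p0 irr bnd' up down by metis
qed

section \<open>From additive bounds to the upper limits\<close>

text \<open>The additive errors \<open>K\<close> and \<open>L\<close> vanish after division by
  \<open>c\<close>, and the lower estimate is needed only at arbitrarily large times.\<close>

lemma limsup_ratio_eq_1:
  fixes M c :: "nat \<Rightarrow> real"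
  assumes pos: "\<And>n. c n > 0" and div: "filterlim c at_top sequentially"
    and le: "\<And>n. n \<ge> 2 \<Longrightarrow> M n \<le> c n + K"
    and ge: "\<And>k. \<exists>n\<ge>k. (1 - 1 / real (Suc k)) * c n - L \<le> M n"
  shows "limsup (\<lambda>n. ereal (M n / c n)) = 1"
proof (rule antisym)
  have inv: "(\<lambda>n. B / c n) \<longlonglongrightarrow> 0" for B
    using div by (intro real_tendsto_divide_at_top[OF tendsto_const])
  have lim: "(\<lambda>n. ereal (1 + K / c n)) \<longlonglongrightarrow> ereal (1 + 0)"
    using inv[of K] by (intro tendsto_ereal tendsto_intros)
  have "limsup (\<lambda>n. ereal (M n / c n)) \<le> limsup (\<lambda>n. ereal (1 + K / c n))"
  proof (rule Limsup_mono)
    show "\<forall>\<^sub>F n in sequentially. ereal (M n / c n) \<le> ereal (1 + K / c n)"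
      using eventually_ge_at_top[of 2]
    proof eventually_elim
      case (elim n)
      then show ?case using le[OF elim] pos[of n] by (simp add: field_simps)
    qed
  qed
  also have "\<dots> = 1"
    using lim_imp_Limsup[OF _ lim] by simp
  finally show "limsup (\<lambda>n. ereal (M n / c n)) \<le> 1" .
  show "1 \<le> limsup (\<lambda>n. ereal (M n / c n))"
  proof (rule ccontr)
    assume "\<not> ?thesis"
    then obtain r where r: "limsup (\<lambda>n. ereal (M n / c n)) < ereal r" "r < 1"
      using ereal_dense2[of "limsup (\<lambda>n. ereal (M n / c n))" 1] by (auto simp: not_le)
    have "(\<lambda>n. 1 / real (Suc n)) \<longlonglongrightarrow> 0"
      using LIMSEQ_inverse_real_of_nat by (simp add: inverse_eq_divide)
    \<comment> \<open>Each of the two error terms may use up less than half of the gap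
      \<open>1 - r\<close>.\<close>
    then have "\<forall>\<^sub>F n in sequentially. 1 / real (Suc n) < (1 - r) / 2"
      using r(2) by (intro order_tendstoD(2)) auto
    moreover have "\<forall>\<^sub>F n in sequentially. L / c n < (1 - r) / 2"
      using r(2) inv by (intro order_tendstoD(2)) auto
    moreover have "\<forall>\<^sub>F n in sequentially. M n / c n < r"
      using Limsup_lessD[OF r(1)] by simp
    ultimately have "\<forall>\<^sub>F n in sequentially. 1 / real (Suc n) < (1 - r) / 2
        \<and> L / c n < (1 - r) / 2 \<and> M n / c n < r"
      by eventually_elim auto
    then obtain k where k: "\<And>n. n \<ge> k \<Longrightarrow> 1 / real (Suc n) < (1 - r) / 2
        \<and> L / c n < (1 - r) / 2 \<and> M n / c n < r"
      by (auto simp: eventually_sequentially)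
    \<comment> \<open>The factor in \<open>ge\<close> involves \<open>k\<close> rather than
      \<open>n\<close>, so the threshold is used both at \<open>k\<close> and at
      \<open>n\<close>.\<close>
    obtain n where n: "n \<ge> k" "(1 - 1 / real (Suc k)) * c n - L \<le> M n" using ge by blast
    define \<epsilon> where "\<epsilon> = 1 / real (Suc k)"
    have "((1 - \<epsilon>) * c n - L) / c n \<le> M n / c n"
      using n(2) pos[of n] unfolding \<epsilon>_def by (intro divide_right_mono) auto
    then have "1 - \<epsilon> - L / c n \<le> M n / c n"
      using pos[of n] by (simp add: diff_divide_distrib)
    moreover have "\<epsilon> < (1 - r) / 2" "L / c n < (1 - r) / 2" "M n / c n < r"
      using k[of k] k[OF n(1)] unfolding \<epsilon>_def by blast+
    moreover have False if "1 - a - b \<le> x" "a < (1 - r) / 2" "b < (1 - r) / 2" "x < r" for a b x :: real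
      using that by argo
    ultimately show False by blast
  qed
qed

lemma max_sum_min_sum:
  assumes "n \<ge> 2"
  shows "\<And>i. 1 \<le> i \<Longrightarrow> i < n \<Longrightarrow> erg_sum \<theta> i 0 \<le> max_sum \<theta> n 0"
    and "\<And>i. 1 \<le> i \<Longrightarrow> i < n \<Longrightarrow> min_sum \<theta> n 0 \<le> erg_sum \<theta> i 0"
    and "\<exists>i. 1 \<le> i \<and> i < n \<and> max_sum \<theta> n 0 = erg_sum \<theta> i 0"
    and "\<exists>i. 1 \<le> i \<and> i < n \<and> min_sum \<theta> n 0 = erg_sum \<theta> i 0"
proof -
  have eq: "{erg_sum \<theta> i 0 |i. i \<in> {1..n-1}} = (\<lambda>i. erg_sum \<theta> i 0) ` {1..n-1}" (is "?S = _")
    by auto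
  have fin: "finite ?S" "?S \<noteq> {}" unfolding eq using assms by auto
  show "erg_sum \<theta> i 0 \<le> max_sum \<theta> n 0" "min_sum \<theta> n 0 \<le> erg_sum \<theta> i 0" if "1 \<le> i" "i < n" for i
    unfolding max_sum_def min_sum_def using fin that by (auto intro!: Max_ge Min_le exI[of _ i])
  show "\<exists>i. 1 \<le> i \<and> i < n \<and> max_sum \<theta> n 0 = erg_sum \<theta> i 0"
    using Max_in[OF fin] assms unfolding max_sum_def[symmetric] by force
  show "\<exists>i. 1 \<le> i \<and> i < n \<and> min_sum \<theta> n 0 = erg_sum \<theta> i 0"
    using Min_in[OF fin] assms unfolding min_sum_def[symmetric] by force
qed

lemma erg_sum_1: "erg_sum \<theta> 1 0 = 1"
  by (simp add: erg_sum_def step_fun_def)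

lemma incseq_divergent_at_top:
  fixes c :: "nat \<Rightarrow> real"
  assumes "incseq c" "\<not> convergent c"
  shows "filterlim c at_top sequentially"
  unfolding filterlim_at_top_gt[of _ _ 0]
proof (intro allI impI)
  fix Z :: real
  have "\<exists>N. Z < c N"
  proof (rule ccontr)
    assume "\<not> ?thesis"
    then have "\<forall>i. c i \<le> Z" by (simp add: not_less)
    then show False
      using incseq_convergent[OF assms(1)] assms(2) by (metis convergent_def)
  qed
  then obtain N where N: "Z < c N" ..
  have "Z \<le> c n" if "N \<le> n" for n
    using N incseqD[OF assms(1) that] by linarith
  then show "\<forall>\<^sub>F n in sequentially. Z \<le> c n"
    by (auto simp: eventually_sequentially)
qed

text \<open>Sublinearity survives the shift because \<open>n + 1 \<le> 2 * n\<close>; the shifted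
  sequences are those fed to \<open>exists_theta\<close>.\<close>

lemma smallo_Suc_le:
  fixes c :: "nat \<Rightarrow> real"
  assumes "\<And>n. c n > 0" "c \<in> o(\<lambda>n. real n)" "\<epsilon> > 0"
  shows "\<forall>\<^sub>F n in sequentially. c (Suc n) \<le> \<epsilon> * real n"
proof -
  have "\<forall>\<^sub>F n in sequentially. c n \<le> (\<epsilon> / 2) * real n"
    using landau_o.smallD[OF assms(2), of "\<epsilon> / 2"] assms(3) by (auto elim: eventually_mono)
  then have "\<forall>\<^sub>F n in sequentially. c (Suc n) \<le> (\<epsilon> / 2) * real (Suc n)"
    by (subst eventually_sequentially_Suc)
  then show ?thesis
    using eventually_ge_at_top[of 1]
  proof eventually_elim
    case (elim n)
    then have "(\<epsilon> / 2) * real (Suc n) \<le> (\<epsilon> / 2) * (2 * real n)"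
      using assms(3) by (intro mult_left_mono) auto
    with elim show ?case by simp
  qed
qed

section \<open>Density and conclusion\<close>

text \<open>Odd numerators over powers of 2 are in lowest terms and dense, and the radius of
  \<open>near\<close> shrinks with the denominator.\<close>

lemma near_subset_exists:
  assumes "0 < \<delta>"
  shows "\<exists>p h. hub p h \<and> (\<forall>\<theta>\<in>near p h. \<bar>\<theta> - x\<bar> < \<delta>)"
proof -
  obtain N :: nat where N: "real N > 1 / \<delta>" using reals_Archimedean2 by blast
  define h :: nat where "h = 2 ^ N"
  have "N < h" by (simp add: h_def)
  then have "1 / \<delta> < real h" using N by linarith
  then have h: "1 / real h < \<delta>" "real h \<ge> 1"
    using assms by (simp_all add: field_simps h_def)
  \<comment> \<open>An odd integer within 1 of \<open>2 * h * x\<close>.\<close>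
  define p where "p = 2 * \<lfloor>real h * x\<rfloor> + 1"
  have "coprime p (2 * int h)"
    by (simp add: h_def p_def coprime_right_2_iff_odd)
  then have "hub p h" using h(2) by (simp add: hub_def)
  moreover have "\<bar>\<theta> - x\<bar> < \<delta>" if "\<theta> \<in> near p h" for \<theta>
  proof -
    have "\<bar>of_int p - 2 * real h * x\<bar> \<le> 1"
      using of_int_floor_le[of "real h * x"] floor_correct[of "real h * x"]
      by (simp add: p_def abs_le_iff mult.assoc) linarith
    then have "\<bar>of_int p - 2 * real h * x\<bar> / (2 * real h) \<le> 1 / (2 * real h)"
      by (intro divide_right_mono) auto
    moreover have "\<bar>of_int p - 2 * real h * x\<bar> / (2 * real h) = \<bar>of_int p / (2 * real h) - x\<bar>"
    proof -
      have "of_int p / (2 * real h) - x = (of_int p - 2 * real h * x) / (2 * real h)"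
        using h(2) by (simp add: field_simps)
      then show ?thesis using h(2) by simp
    qed
    ultimately have "\<bar>of_int p / (2 * real h) - x\<bar> \<le> 1 / (2 * real h)" by simp
    moreover have "\<bar>of_int p / (2 * real h) - \<theta>\<bar> \<le> 1 / (2 * (real h)\<^sup>2)"
      using that by (simp add: near_def dist_real_def)
    moreover have "1 / (2 * (real h)\<^sup>2) \<le> 1 / (2 * real h)"
      using h(2) by (intro divide_left_mono) (auto simp: power2_eq_square)
    moreover have "1 / (2 * real h) + 1 / (2 * real h) = 1 / real h" by simp
    ultimately show ?thesis using h(1) by linarith
  qed
  ultimately show ?thesis by blast
qed

theorem theorem1p2:
  fixes c d :: "nat \<Rightarrow> real"
  assumes "\<And>n. c n > 0" and "\<And>n. d n > 0"
    and "incseq c" and "incseq d"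
    and "c \<in> o(\<lambda>n. real n)" and "d \<in> o(\<lambda>n. real n)"
    and "(\<lambda>n. c (Suc n) - c n) \<in> O(\<lambda>_. 1)"
    and "(\<lambda>n. d (Suc n) - d n) \<in> O(\<lambda>_. 1)"
    and "\<not> convergent c \<or> \<not> convergent d"
  shows "\<exists>\<Theta> \<subseteq> {0<..<1} - \<rat>. {0<..<1} \<subseteq> closure \<Theta> \<and>
    (\<forall>\<theta>\<in>\<Theta>.
      (\<not> convergent c \<longrightarrow> limsup (\<lambda>n. ereal (max_sum \<theta> n 0 / c n)) = 1) \<and>
      (bounded (range c) \<longrightarrow> bounded ((\<lambda>n. max_sum \<theta> n 0) ` {2..})) \<and>
      (\<not> convergent d \<longrightarrow> limsup (\<lambda>n. ereal (\<bar>min_sum \<theta> n 0\<bar> / d n)) = 1) \<and>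
      (bounded (range d) \<longrightarrow> bounded ((\<lambda>n. min_sum \<theta> n 0) ` {2..})))"
proof -
  define P where "P = (\<lambda>\<theta>.
      (\<not> convergent c \<longrightarrow> limsup (\<lambda>n. ereal (max_sum \<theta> n 0 / c n)) = 1) \<and>
      (bounded (range c) \<longrightarrow> bounded ((\<lambda>n. max_sum \<theta> n 0) ` {2..})) \<and>
      (\<not> convergent d \<longrightarrow> limsup (\<lambda>n. ereal (\<bar>min_sum \<theta> n 0\<bar> / d n)) = 1) \<and>
      (bounded (range d) \<longrightarrow> bounded ((\<lambda>n. min_sum \<theta> n 0) ` {2..})))"
  have mono: "c i \<le> c j" "d i \<le> d j" if "i \<le> j" for i j
    using assms(3,4) that by (simp_all add: incseq_def)
  \<comment> \<open>The maximum with index \<open>n\<close> runs over times up to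
    \<open>n - 1\<close>, so the sum at time \<open>i\<close> first enters at index
    \<open>i + 1\<close> and is compared with \<open>c (i + 1)\<close>.\<close>
  define c' d' where "c' = (\<lambda>n. c (Suc n))" and "d' = (\<lambda>n. d (Suc n))"
  have top: "filterlim c at_top sequentially" if "\<not> convergent c"
    using incseq_divergent_at_top[OF assms(3) that] .
  have top': "filterlim d at_top sequentially" if "\<not> convergent d"
    using incseq_divergent_at_top[OF assms(4) that] .
  have sh: "filterlim c' at_top sequentially \<longleftrightarrow> filterlim c at_top sequentially"
    "filterlim d' at_top sequentially \<longleftrightarrow> filterlim d at_top sequentially"
    unfolding c'_def d'_def by (rule filterlim_sequentially_Suc)+
  have dense: "\<exists>\<theta>. \<bar>\<theta> - x\<bar> < \<delta> \<and> \<theta> \<notin> \<rat> \<and> P \<theta>" if \<delta>: "0 < \<delta>" for x \<delta>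
  proof -
    obtain p0 h0 where ph: "hub p0 h0" "\<And>\<theta>. \<theta> \<in> near p0 h0 \<Longrightarrow> \<bar>\<theta> - x\<bar> < \<delta>"
      using near_subset_exists[OF \<delta>] by blast
    have "filterlim c' at_top sequentially \<or> filterlim d' at_top sequentially"
      using assms(9) top top' sh by blast
    moreover have "c' n > 0" "d' n > 0" for n using assms by (simp_all add: c'_def d'_def)
    moreover have "incseq c'" "incseq d'" using mono by (auto simp: incseq_def c'_def d'_def)
    moreover have "\<forall>\<^sub>F n in sequentially. c' n \<le> \<epsilon> * real n" "\<forall>\<^sub>F n in sequentially. d' n \<le> \<epsilon> * real n"
      if "\<epsilon> > 0" for \<epsilon>
      unfolding c'_def d'_def using assms that by (auto intro: smallo_Suc_le)
    ultimately obtain \<theta> K where \<theta>: "\<theta> \<in> near p0 h0" "\<theta> \<notin> \<rat>"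
      and bd: "\<And>n. 1 \<le> n \<Longrightarrow> erg_sum \<theta> n 0 \<le> c' n + K \<and> - erg_sum \<theta> n 0 \<le> d' n + K"
      and up: "\<And>k. filterlim c' at_top sequentially \<Longrightarrow>
          \<exists>n\<ge>k. n \<ge> 1 \<and> (1 - 1 / real (Suc k)) * c' n \<le> erg_sum \<theta> n 0"
      and down: "\<And>k. filterlim d' at_top sequentially \<Longrightarrow>
          \<exists>n\<ge>k. n \<ge> 1 \<and> (1 - 1 / real (Suc k)) * d' n \<le> 2 - erg_sum \<theta> n 0"
      using exists_theta[OF ph(1), of c' d'] by blast
    have Mle: "max_sum \<theta> n 0 \<le> c n + K" "- min_sum \<theta> n 0 \<le> d n + K" if n: "n \<ge> 2" for n
    proof -
      have *: "c' i \<le> c n" "d' i \<le> d n" if "i < n" for i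
        using mono[of "Suc i" n] that by (simp_all add: c'_def d'_def)
      obtain i where "1 \<le> i" "i < n" "max_sum \<theta> n 0 = erg_sum \<theta> i 0"
        using max_sum_min_sum(3)[OF n] by blast
      then show "max_sum \<theta> n 0 \<le> c n + K" using bd[of i] *[of i] by simp
      obtain j where "1 \<le> j" "j < n" "min_sum \<theta> n 0 = erg_sum \<theta> j 0"
        using max_sum_min_sum(4)[OF n] by blast
      then show "- min_sum \<theta> n 0 \<le> d n + K" using bd[of j] *[of j] by simp
    qed
    \<comment> \<open>The sum at time 1 is always 1, which bounds the maximum from below and the
      minimum from above.\<close>
    have M1: "max_sum \<theta> n 0 \<ge> 1" "min_sum \<theta> n 0 \<le> 1" if "n \<ge> 2" for n
      using max_sum_min_sum(1,2)[OF that, of 1 \<theta>] erg_sum_1[of \<theta>] that by simp_all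
    have "limsup (\<lambda>n. ereal (max_sum \<theta> n 0 / c n)) = 1" if nc: "\<not> convergent c"
    proof (rule limsup_ratio_eq_1[OF assms(1) top[OF nc] Mle(1)])
      fix k
      obtain n where n: "n \<ge> k" "n \<ge> 1" "(1 - 1 / real (Suc k)) * c' n \<le> erg_sum \<theta> n 0"
        using up sh top[OF nc] by blast
      then have "(1 - 1 / real (Suc k)) * c (Suc n) - 0 \<le> max_sum \<theta> (Suc n) 0"
        using max_sum_min_sum(1)[of "Suc n" n \<theta>] by (simp add: c'_def)
      then show "\<exists>n\<ge>k. (1 - 1 / real (Suc k)) * c n - 0 \<le> max_sum \<theta> n 0"
        using n(1) by (meson le_Suc_eq)
    qed
    moreover have "limsup (\<lambda>n. ereal (\<bar>min_sum \<theta> n 0\<bar> / d n)) = 1" if nd: "\<not> convergent d"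
    proof (rule limsup_ratio_eq_1[OF assms(2) top'[OF nd]])
      \<comment> \<open>The minimum may be positive, but is at most 1, whence the constant
        \<open>\<bar>K\<bar> + 1\<close>.\<close>
      show "\<bar>min_sum \<theta> n 0\<bar> \<le> d n + (\<bar>K\<bar> + 1)" if "n \<ge> 2" for n
        using Mle(2)[OF that] M1(2)[OF that] assms(2)[of n] by linarith
      fix k
      obtain n where n: "n \<ge> k" "n \<ge> 1" "(1 - 1 / real (Suc k)) * d' n \<le> 2 - erg_sum \<theta> n 0"
        using down sh top'[OF nd] by blast
      then have "(1 - 1 / real (Suc k)) * d (Suc n) - 2 \<le> \<bar>min_sum \<theta> (Suc n) 0\<bar>"
        using max_sum_min_sum(2)[of "Suc n" n \<theta>] by (simp add: d'_def)
      then show "\<exists>n\<ge>k. (1 - 1 / real (Suc k)) * d n - 2 \<le> \<bar>min_sum \<theta> n 0\<bar>"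
        using n(1) by (meson le_Suc_eq)
    qed
    moreover have "bounded ((\<lambda>n. max_sum \<theta> n 0) ` {2..})" if bdd: "bounded (range c)"
    proof -
      obtain B where "\<forall>n. \<bar>c n\<bar> \<le> B"
        using bdd by (auto simp: bounded_iff)
      then have B: "c n \<le> B" for n using abs_le_D1 by blast
      have "max_sum \<theta> n 0 \<in> {1..B + K}" if "n \<ge> 2" for n
        using Mle(1)[OF that] M1(1)[OF that] B[of n] by simp
      then show ?thesis by (intro bounded_subset[OF bounded_closed_interval[of 1 "B + K"]]) auto
    qed
    moreover have "bounded ((\<lambda>n. min_sum \<theta> n 0) ` {2..})" if bdd: "bounded (range d)"
    proof -
      obtain B where "\<forall>n. \<bar>d n\<bar> \<le> B"
        using bdd by (auto simp: bounded_iff)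
      then have B: "d n \<le> B" for n using abs_le_D1 by blast
      have "min_sum \<theta> n 0 \<in> {- (B + K)..1}" if "n \<ge> 2" for n
        using Mle(2)[OF that] M1(2)[OF that] B[of n] by simp
      then show ?thesis by (intro bounded_subset[OF bounded_closed_interval[of "- (B + K)" 1]]) auto
    qed
    ultimately have "P \<theta>" by (simp add: P_def)
    then show ?thesis using \<theta> ph(2) by blast
  qed
  define \<Theta> where "\<Theta> = {\<theta> \<in> {0<..<1} - \<rat>. P \<theta>}"
  have "{0<..<1} \<subseteq> closure \<Theta>"
  proof
    fix x :: real assume x: "x \<in> {0<..<1}"
    show "x \<in> closure \<Theta>"
      unfolding closure_approachable
    proof (intro allI impI)
      fix e :: real assume "e > 0"
      \<comment> \<open>The bound \<open>min x (1 - x)\<close> keeps \<open>\<theta>\<close> inside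
        the unit interval.\<close>
      then obtain \<theta> where "\<bar>\<theta> - x\<bar> < min e (min x (1 - x))" "\<theta> \<notin> \<rat>" "P \<theta>"
        using dense[of "min e (min x (1 - x))" x] x by auto
      then show "\<exists>y\<in>\<Theta>. dist y x < e"
        by (intro bexI[of _ \<theta>]) (auto simp: \<Theta>_def dist_real_def)
    qed
  qed
  moreover have "\<Theta> \<subseteq> {0<..<1} - \<rat>" "\<forall>\<theta>\<in>\<Theta>. P \<theta>" by (auto simp: \<Theta>_def)
  ultimately show ?thesis unfolding P_def by blast
qed

end
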